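(* Suppose $$0<\alpha_1\le\alpha_2\le\dots\le\alpha_p,\qquad 0<\beta_1\le\beta_2\le\dots\le\beta_p,\qquad \sum_{j=1}^k\alpha_j\le\sum_{j=1}^k\beta_j\ \text{ for } k=1,\dots,p,$$ and denote $A_i=1/\alpha_i$, $B_i=1/\beta_i$, $i=1,\dots,p$. Let $Y>X>0$. Then the function $$F(a)=\prod_{i=1}^p\frac{\Gamma(A_iX+a)\,\Gamma(B_iY+a)}{\Gamma(A_iY+a)\,\Gamma(B_iX+a)}$$ is monotone decreasing on $[1,\infty)$.
   Context: $\Gamma$ is Euler's gamma function. "Monotone decreasing" is understood in the non-strict sense (non-increasing); note that the hypotheses allow $\alpha_i=\beta_i$ for all $i$, in which case $F\equiv1$. *)

theory Defs
  imports "HOL-Analysis.Analysis"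
begin

end

theory Submission
  imports Defs "HOL-Real_Asymp.Real_Asymp"
begin

text \<open>
  Since \<open>(ln \<Gamma>)' = \<psi>\<close> (the digamma function), the logarithmic derivative of \<open>F\<close> at \<open>a\<close> is
  \<open>\<Sum>i. h (\<beta> i) - h (\<alpha> i)\<close>, where \<open>h t = \<psi> (Y/t + a) - \<psi> (X/t + a)\<close>. The hypotheses on the
  prefix sums say that \<open>\<beta>\<close> is weakly supermajorized by \<open>\<alpha>\<close>, so \<open>\<Sum>i. h (\<beta> i) \<le> \<Sum>i. h (\<alpha> i)\<close> as soon as
  \<open>h\<close> is decreasing and convex on the positive half-line
  (\<open>sum_le_of_weak_majorization\<close>, the inequality of Tomic and Weyl).

  One differentiates \<open>t \<mapsto> \<psi> (s/t + a)\<close> twice and finds that both properties of \<open>h\<close> are statements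
  about the function \<open>u\<^sup>2 \<psi>' (u + a)\<close> of \<open>u > 0\<close>: \<open>h\<close> is convex if this function is convex, and
  decreasing if its quotient by \<open>u\<close> increases, which also follows from convexity because the function
  vanishes at \<open>0\<close>. The convexity (\<open>polygamma_curvature_nonneg\<close>) is where \<open>a \<ge> 1\<close> enters.
  With \<open>c = a + n\<close> and \<open>z = u + c\<close>, the second derivative is the series
  \<open>\<Sum>n. 2 c (c - 2 u) / z\<^sup>4\<close>. Its terms change sign, but each of them is at least twice the
  telescoping difference \<open>T\<^sub>n - T\<^sub>n\<^sub>+\<^sub>1\<close> with \<open>T\<^sub>n = c (c - 1) (2 z + 3) / (2 z\<^sup>4)\<close>, so the sum is at
  least \<open>2 T\<^sub>0\<close>, and \<open>T\<^sub>0 \<ge> 0\<close> because \<open>a (a - 1) \<ge> 0\<close>.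
\<close>

section \<open>Weak majorization\<close>

text \<open>
  Abel summation: the stronger lower bound \<open>d k * (\<Sum>i=1..k. e i)\<close> is what survives the induction,
  as replacing \<open>d k\<close> by the smaller \<open>d (Suc k)\<close> only lowers it.
\<close>
lemma weighted_sum_ge_last_weight:
  fixes d e :: "nat \<Rightarrow> real"
  assumes "k \<ge> 1"
    and "\<And>i. 1 \<le> i \<Longrightarrow> i < k \<Longrightarrow> d (Suc i) \<le> d i"
    and "\<And>j. 1 \<le> j \<Longrightarrow> j \<le> k \<Longrightarrow> (\<Sum>i=1..j. e i) \<ge> 0"
  shows "d k * (\<Sum>i=1..k. e i) \<le> (\<Sum>i=1..k. d i * e i)"
  using assms
proof (induction k rule: dec_induct)
  case base
  show ?case by simp
next
  case (step k)
  have "d (Suc k) * (\<Sum>i=1..k. e i) \<le> d k * (\<Sum>i=1..k. e i)"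
    using step.prems step.hyps by (intro mult_right_mono) auto
  also have "\<dots> \<le> (\<Sum>i=1..k. d i * e i)"
    using step.prems by (intro step.IH) auto
  finally show ?case
    by (simp add: algebra_simps)
qed

lemma tangent_below_of_mono_derivative:
  fixes h h' :: "real \<Rightarrow> real"
  assumes deriv: "\<And>t. t > 0 \<Longrightarrow> (h has_real_derivative h' t) (at t)"
    and mono: "\<And>s t. 0 < s \<Longrightarrow> s \<le> t \<Longrightarrow> h' s \<le> h' t"
    and "s > 0" "t > 0"
  shows "h t + h' t * (s - t) \<le> h s"
proof (cases s t rule: linorder_cases)
  case less
  then obtain \<xi> where \<xi>: "s < \<xi>" "\<xi> < t" "h t - h s = (t - s) * h' \<xi>"
    using MVT2[OF less, of h h'] deriv \<open>s > 0\<close> by force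
  have "(t - s) * h' \<xi> \<le> (t - s) * h' t"
    using \<xi> \<open>s > 0\<close> less by (intro mult_left_mono mono) auto
  with \<xi>(3) show ?thesis by (simp add: algebra_simps)
next
  case greater
  then obtain \<xi> where \<xi>: "t < \<xi>" "\<xi> < s" "h s - h t = (s - t) * h' \<xi>"
    using MVT2[OF greater, of h h'] deriv \<open>t > 0\<close> by force
  have "(s - t) * h' t \<le> (s - t) * h' \<xi>"
    using \<xi> \<open>t > 0\<close> greater by (intro mult_left_mono mono) auto
  with \<xi>(3) show ?thesis by (simp add: algebra_simps)
qed simp

text \<open>
  Convexity bounds \<open>h (\<alpha> i) - h (\<beta> i)\<close> below by \<open>- h' (\<beta> i) * (\<beta> i - \<alpha> i)\<close>. The weights
  \<open>- h' (\<beta> i)\<close> are nonnegative and decrease with \<open>i\<close>, so Abel summation applies.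
\<close>
lemma sum_le_of_weak_majorization:
  fixes h h' :: "real \<Rightarrow> real" and \<alpha> \<beta> :: "nat \<Rightarrow> real"
  assumes deriv: "\<And>t. t > 0 \<Longrightarrow> (h has_real_derivative h' t) (at t)"
    and mono: "\<And>s t. 0 < s \<Longrightarrow> s \<le> t \<Longrightarrow> h' s \<le> h' t"
    and nonpos: "\<And>t. t > 0 \<Longrightarrow> h' t \<le> 0"
    and "p \<ge> 1"
    and \<alpha>: "\<And>i. i \<in> {1..p} \<Longrightarrow> \<alpha> i > 0"
    and \<beta>: "\<And>i. i \<in> {1..p} \<Longrightarrow> \<beta> i > 0" "mono_on {1..p} \<beta>"
    and prefix: "\<And>k. k \<in> {1..p} \<Longrightarrow> (\<Sum>j=1..k. \<alpha> j) \<le> (\<Sum>j=1..k. \<beta> j)"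
  shows "(\<Sum>i=1..p. h (\<beta> i)) \<le> (\<Sum>i=1..p. h (\<alpha> i))"
proof -
  have "0 \<le> - h' (\<beta> p) * (\<Sum>i=1..p. \<beta> i - \<alpha> i)"
    using nonpos[OF \<beta>(1)[of p]] prefix[of p] \<open>p \<ge> 1\<close>
    by (intro mult_nonneg_nonneg) (auto simp: sum_subtractf)
  also have "\<dots> \<le> (\<Sum>i=1..p. - h' (\<beta> i) * (\<beta> i - \<alpha> i))"
  proof (rule weighted_sum_ge_last_weight[where d = "\<lambda>i. - h' (\<beta> i)"])
    fix i assume "1 \<le> i" "i < p"
    then show "- h' (\<beta> (Suc i)) \<le> - h' (\<beta> i)"
      using \<beta> by (auto intro!: mono intro: mono_onD)
  qed (use \<open>p \<ge> 1\<close> prefix in \<open>auto simp: sum_subtractf\<close>)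
  also have "\<dots> \<le> (\<Sum>i=1..p. h (\<alpha> i) - h (\<beta> i))"
  proof (rule sum_mono)
    fix i assume i: "i \<in> {1..p}"
    have "h (\<beta> i) + h' (\<beta> i) * (\<alpha> i - \<beta> i) \<le> h (\<alpha> i)"
      using tangent_below_of_mono_derivative[OF deriv mono \<alpha>[OF i] \<beta>(1)[OF i]] by blast
    then show "- h' (\<beta> i) * (\<beta> i - \<alpha> i) \<le> h (\<alpha> i) - h (\<beta> i)"
      by (simp add: algebra_simps)
  qed
  finally show ?thesis by (simp add: sum_subtractf)
qed

section \<open>Convexity of the scaled trigamma function\<close>

lemma DERIV_Polygamma_pos [derivative_intros]:
  fixes f :: "real \<Rightarrow> real"
  assumes "(f has_real_derivative f') (at x)" "f x > 0"
  shows "((\<lambda>x. Polygamma n (f x)) has_real_derivative Polygamma (Suc n) (f x) * f') (at x)"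
proof -
  have "f x \<notin> \<int>\<^sub>\<le>\<^sub>0" using assms(2) by (auto elim!: nonpos_Ints_cases)
  then show ?thesis
    by (rule DERIV_chain2[OF has_field_derivative_Polygamma assms(1)])
qed

lemma sums_ge_of_telescoping:
  fixes f T :: "nat \<Rightarrow> real"
  assumes "f sums s" "T \<longlonglongrightarrow> 0" "\<And>n. T n - T (Suc n) \<le> f n"
  shows "T 0 \<le> s"
  using sums_le[OF _ telescope_sums'[OF assms(2)] assms(1)] assms(3) by simp

text \<open>
  In terms of \<open>c\<close> and \<open>z\<close> the terms on the right are \<open>c (c - 2 (z - c)) / z\<^sup>4\<close> with \<open>z - c\<close> fixed.
  The telescoping sequence has the shape of the Euler-Maclaurin expansion of the tail of their sum,
  whose leading terms are \<open>(c\<^sup>2 - c + 1/6) / z\<^sup>3\<close>; dropping the \<open>1/6\<close> costs nothing at \<open>c \<ge> 1\<close> and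
  provides the slack that makes every single step of the comparison hold.
  After clearing the common factor \<open>c (c + 1)\<close>, the difference of the two sides has the sign of
  \<open>(2 z + 5) z\<^sup>4 - (2 z - 3) (z + 1)\<^sup>4 = 10 z\<^sup>2 + 10 z + 3\<close>.
\<close>
lemma telescoping_step:
  fixes c z :: real
  assumes "c > 0" "z > 0"
  shows "c * (c - 1) * (2 * z + 3) / (2 * z ^ 4)
       - (c + 1) * c * (2 * (z + 1) + 3) / (2 * (z + 1) ^ 4) \<le> c * (3 * c - 2 * z) / z ^ 4"
proof -
  have "(2 * z + 5) * z ^ 4 - (2 * z - 3) * (z + 1) ^ 4 = 10 * z ^ 2 + 10 * z + 3"
    by algebra
  then have "(2 * z - 3) * (z + 1) ^ 4 \<le> (2 * z + 5) * z ^ 4"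
    using assms by (smt (verit) zero_le_power2)
  then have "(2 * z - 3) / z ^ 4 \<le> (2 * z + 5) / (z + 1) ^ 4"
    using assms by (simp add: divide_simps)
  then have "c * (c + 1) / 2 * ((2 * z - 3) / z ^ 4) \<le> c * (c + 1) / 2 * ((2 * z + 5) / (z + 1) ^ 4)"
    using assms by (intro mult_left_mono) auto
  moreover have "c * (c - 1) * (2 * z + 3) / (2 * z ^ 4) - c * (3 * c - 2 * z) / z ^ 4
      = c * (c + 1) / 2 * ((2 * z - 3) / z ^ 4)"
    using assms by (simp add: divide_simps) algebra
  moreover have "(c + 1) * c * (2 * (z + 1) + 3) / (2 * (z + 1) ^ 4)
      = c * (c + 1) / 2 * ((2 * z + 5) / (z + 1) ^ 4)"
    by (simp add: divide_simps; algebra)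
  ultimately show ?thesis by linarith
qed

text \<open>The left-hand side is the second derivative of \<open>u\<^sup>2 \<psi>' (u + a)\<close>.\<close>
lemma polygamma_curvature_nonneg:
  fixes a u :: real
  assumes "a \<ge> 1" "u \<ge> 0"
  shows "0 \<le> 2 * Polygamma 1 (u + a) + 4 * u * Polygamma 2 (u + a) + u ^ 2 * Polygamma 3 (u + a)"
proof -
  define z where "z n = u + a + real n" for n
  define c where "c n = a + real n" for n
  define T where "T n = c n * (c n - 1) * (2 * z n + 3) / (2 * z n ^ 4)" for n
  have pos: "c n > 0" "z n > 0" for n
    using assms by (auto simp: c_def z_def)
  have "u + a \<noteq> 0" using assms by simp
  note S = Polygamma_LIMSEQ[OF this]
  have S1: "(\<lambda>n. inverse (z n ^ 2)) sums Polygamma 1 (u + a)"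
    using S[of 1] by (simp add: z_def numeral_2_eq_2)
  have S2: "(\<lambda>n. inverse (z n ^ 3)) sums (- Polygamma 2 (u + a) / 2)"
    using S[of 2] by (simp add: z_def eval_nat_numeral)
  have S3: "(\<lambda>n. inverse (z n ^ 4)) sums (Polygamma 3 (u + a) / 6)"
    using S[of 3] by (simp add: z_def eval_nat_numeral)
  have "(\<lambda>n. inverse (z n ^ 2) - 4 * u * inverse (z n ^ 3) + 3 * u ^ 2 * inverse (z n ^ 4))
          sums (Polygamma 1 (u + a) - 4 * u * (- Polygamma 2 (u + a) / 2)
                + 3 * u ^ 2 * (Polygamma 3 (u + a) / 6))"
    by (intro sums_add sums_diff sums_mult S1 S2 S3)
  moreover have "inverse (z n ^ 2) - 4 * u * inverse (z n ^ 3) + 3 * u ^ 2 * inverse (z n ^ 4)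
      = c n * (3 * c n - 2 * z n) / z n ^ 4" for n
  proof -
    have "inverse (z n ^ 2) = z n ^ 2 / z n ^ 4" "inverse (z n ^ 3) = z n / z n ^ 4"
      using pos[of n] by (auto simp: field_simps eval_nat_numeral)
    then have "inverse (z n ^ 2) - 4 * u * inverse (z n ^ 3) + 3 * u ^ 2 * inverse (z n ^ 4)
      = (z n ^ 2 - 4 * u * z n + 3 * u ^ 2) / z n ^ 4"
      by (simp add: divide_inverse algebra_simps)
    also have "z n ^ 2 - 4 * u * z n + 3 * u ^ 2 = c n * (3 * c n - 2 * z n)"
      unfolding z_def c_def by algebra
    finally show ?thesis .
  qed
  ultimately have series: "(\<lambda>n. c n * (3 * c n - 2 * z n) / z n ^ 4)
          sums (Polygamma 1 (u + a) + 2 * u * Polygamma 2 (u + a) + u ^ 2 * Polygamma 3 (u + a) / 2)"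
    by (simp add: mult.assoc)
  have "T \<longlonglongrightarrow> 0"
    unfolding T_def[abs_def] c_def z_def by real_asymp
  moreover have "T n - T (Suc n) \<le> c n * (3 * c n - 2 * z n) / z n ^ 4" for n
  proof -
    have "c (Suc n) = c n + 1" "z (Suc n) = z n + 1"
      by (simp_all add: c_def z_def)
    then show ?thesis
      using telescoping_step[OF pos(1)[of n] pos(2)[of n]] by (simp add: T_def)
  qed
  ultimately have "T 0 \<le> Polygamma 1 (u + a) + 2 * u * Polygamma 2 (u + a)
      + u ^ 2 * Polygamma 3 (u + a) / 2"
    by (intro sums_ge_of_telescoping[OF series])
  moreover have "T 0 \<ge> 0"
    using assms by (simp add: T_def c_def z_def)
  ultimately show ?thesis by simp
qed

lemma DERIV_sq_trigamma:
  fixes a u :: real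
  assumes "u + a > 0"
  shows "((\<lambda>u. u ^ 2 * Polygamma 1 (u + a)) has_real_derivative
           2 * u * Polygamma 1 (u + a) + u ^ 2 * Polygamma 2 (u + a)) (at u)"
  using assms by (auto intro!: derivative_eq_intros simp: numeral_2_eq_2 algebra_simps)

lemma deriv_sq_trigamma_mono:
  fixes a u v :: real
  assumes "a \<ge> 1" "0 \<le> u" "u \<le> v"
  shows "2 * u * Polygamma 1 (u + a) + u ^ 2 * Polygamma 2 (u + a)
       \<le> 2 * v * Polygamma 1 (v + a) + v ^ 2 * Polygamma 2 (v + a)"
proof (rule DERIV_nonneg_imp_nondecreasing[OF \<open>u \<le> v\<close>])
  fix x assume "u \<le> x" "x \<le> v"
  then have x: "x \<ge> 0" "x + a > 0" using assms by auto
  have "((\<lambda>u. 2 * u * Polygamma 1 (u + a) + u ^ 2 * Polygamma 2 (u + a)) has_real_derivative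
      2 * Polygamma 1 (x + a) + 4 * x * Polygamma 2 (x + a) + x ^ 2 * Polygamma 3 (x + a)) (at x)"
    using x by (auto intro!: derivative_eq_intros simp: eval_nat_numeral algebra_simps)
  with polygamma_curvature_nonneg[OF \<open>a \<ge> 1\<close> x(1)]
  show "\<exists>y. ((\<lambda>u. 2 * u * Polygamma 1 (u + a) + u ^ 2 * Polygamma 2 (u + a))
              has_real_derivative y) (at x) \<and> 0 \<le> y"
    by blast
qed

text \<open>
  The slope of the chord from the origin of the convex function \<open>u\<^sup>2 \<psi>' (u + a)\<close> is
  \<open>u \<psi>' (u + a)\<close>. By the mean value theorem it equals the derivative at an intermediate point, which
  is at most the derivative at \<open>x\<close>; that is to say that the slope has nonnegative derivative at \<open>x\<close>.
\<close>
lemma scaled_trigamma_mono: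
  fixes a u v :: real
  assumes "a \<ge> 1" "0 < u" "u \<le> v"
  shows "u * Polygamma 1 (u + a) \<le> v * Polygamma 1 (v + a)"
proof (rule DERIV_nonneg_imp_nondecreasing[OF \<open>u \<le> v\<close>])
  fix x assume "u \<le> x" "x \<le> v"
  then have x: "x > 0" "x + a > 0" using assms by auto
  let ?M = "\<lambda>u. 2 * u * Polygamma 1 (u + a) + u ^ 2 * Polygamma 2 (u + a)"
  obtain \<xi> where \<xi>: "0 < \<xi>" "\<xi> < x" "x ^ 2 * Polygamma 1 (x + a) = x * ?M \<xi>"
    using MVT2[OF x(1), of "\<lambda>u. u ^ 2 * Polygamma 1 (u + a)" ?M] DERIV_sq_trigamma \<open>a \<ge> 1\<close>
    by force
  have "x * (x * Polygamma 1 (x + a)) = x * ?M \<xi>"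
    using \<xi>(3) by (simp add: power2_eq_square)
  also have "\<dots> \<le> x * ?M x"
    using \<xi> x by (intro mult_left_mono deriv_sq_trigamma_mono[OF \<open>a \<ge> 1\<close>]) auto
  also have "\<dots> = x * (x * (2 * Polygamma 1 (x + a) + x * Polygamma 2 (x + a)))"
    by (simp add: algebra_simps power2_eq_square)
  finally have "0 \<le> Polygamma 1 (x + a) + x * Polygamma 2 (x + a)"
    using x by simp
  moreover have "((\<lambda>u. u * Polygamma 1 (u + a)) has_real_derivative
      Polygamma 1 (x + a) + x * Polygamma 2 (x + a)) (at x)"
    using x by (auto intro!: derivative_eq_intros simp: eval_nat_numeral algebra_simps)
  ultimately show "\<exists>y. ((\<lambda>u. u * Polygamma 1 (u + a)) has_real_derivative y) (at x) \<and> 0 \<le> y"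
    by blast
qed

section \<open>The logarithmic derivative\<close>

text \<open>
  In the variable \<open>u = s / t\<close> the first derivative is \<open>- u \<psi>' (u + a) / t\<close>, and the second one is
  \<open>1 / t\<^sup>2\<close> times the derivative of \<open>u\<^sup>2 \<psi>' (u + a)\<close>. Monotonicity in \<open>u\<close> of the factors of \<open>1 / t\<close> and
  \<open>1 / t\<^sup>2\<close> therefore decides the signs of the derivatives of the difference between \<open>s = Y\<close> and
  \<open>s = X\<close>.
\<close>
lemma DERIV_Digamma_reciprocal:
  fixes a s t :: real
  assumes "a > 0" "s > 0" "t > 0"
  shows "((\<lambda>t. Digamma (s / t + a)) has_real_derivative
           - (s / t * Polygamma 1 (s / t + a)) / t) (at t)"
  using assms by (auto intro!: derivative_eq_intros add_pos_pos simp: field_simps)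

lemma DERIV_trigamma_reciprocal:
  fixes a s t :: real
  assumes "a > 0" "s > 0" "t > 0"
  shows "((\<lambda>t. - (s / t * Polygamma 1 (s / t + a)) / t) has_real_derivative
           (2 * (s / t) * Polygamma 1 (s / t + a) + (s / t) ^ 2 * Polygamma 2 (s / t + a)) / t ^ 2)
         (at t)"
  using assms
  by (auto intro!: derivative_eq_intros add_pos_pos simp: field_simps eval_nat_numeral)

lemma sum_Digamma_diff_le:
  fixes \<alpha> \<beta> :: "nat \<Rightarrow> real" and a X Y :: real
  assumes "a \<ge> 1" "0 < X" "X < Y" "p \<ge> 1"
    and "\<And>i. i \<in> {1..p} \<Longrightarrow> \<alpha> i > 0"
    and "\<And>i. i \<in> {1..p} \<Longrightarrow> \<beta> i > 0" "mono_on {1..p} \<beta>"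
    and "\<And>k. k \<in> {1..p} \<Longrightarrow> (\<Sum>j=1..k. \<alpha> j) \<le> (\<Sum>j=1..k. \<beta> j)"
  shows "(\<Sum>i=1..p. Digamma (Y / \<beta> i + a) - Digamma (X / \<beta> i + a))
       \<le> (\<Sum>i=1..p. Digamma (Y / \<alpha> i + a) - Digamma (X / \<alpha> i + a))"
proof -
  let ?D = "\<lambda>s t. - (s / t * Polygamma 1 (s / t + a)) / t"
  let ?M = "\<lambda>u. 2 * u * Polygamma 1 (u + a) + u ^ 2 * Polygamma 2 (u + a)"
  let ?h = "\<lambda>t. Digamma (Y / t + a) - Digamma (X / t + a)"
  let ?h' = "\<lambda>t. ?D Y t - ?D X t"
  have "a > 0" "Y > 0" using assms by auto
  have frac: "0 < X / t" "X / t \<le> Y / t" if "t > 0" for t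
    using that assms by (auto intro: divide_right_mono)
  show ?thesis
  proof (rule sum_le_of_weak_majorization[where h = ?h and h' = ?h'])
    fix t :: real assume t: "t > 0"
    show "(?h has_real_derivative ?h' t) (at t)"
      by (intro DERIV_diff DERIV_Digamma_reciprocal) (use assms t in auto)
    have "X / t * Polygamma 1 (X / t + a) / t \<le> Y / t * Polygamma 1 (Y / t + a) / t"
      using scaled_trigamma_mono[OF \<open>a \<ge> 1\<close> frac[OF t]] t by (intro divide_right_mono) auto
    then show "?h' t \<le> 0" by simp
  next
    fix s t :: real assume st: "0 < s" "s \<le> t"
    show "?h' s \<le> ?h' t"
    proof (rule DERIV_nonneg_imp_nondecreasing[OF st(2)])
      fix x assume "s \<le> x" "x \<le> t"
      with st have x: "x > 0" by simp
      have "(?h' has_real_derivative ?M (Y / x) / x ^ 2 - ?M (X / x) / x ^ 2) (at x)"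
        by (intro DERIV_diff DERIV_trigamma_reciprocal \<open>a > 0\<close> \<open>Y > 0\<close> \<open>0 < X\<close> x)
      moreover have "?M (X / x) / x ^ 2 \<le> ?M (Y / x) / x ^ 2"
        using deriv_sq_trigamma_mono[OF \<open>a \<ge> 1\<close> less_imp_le[OF frac(1)[OF x]] frac(2)[OF x]]
        by (intro divide_right_mono) auto
      ultimately show "\<exists>y. (?h' has_real_derivative y) (at x) \<and> 0 \<le> y"
        by (intro exI[of _ "?M (Y / x) / x ^ 2 - ?M (X / x) / x ^ 2"]) simp
    qed
  qed (use assms in auto)
qed

theorem theorem4p1:
  fixes p :: nat and \<alpha> \<beta> A B :: "nat \<Rightarrow> real" and X Y :: real and F :: "real \<Rightarrow> real"
  assumes "p \<ge> 1"
    and "0 < \<alpha> 1" and "mono_on {1..p} \<alpha>"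
    and "0 < \<beta> 1" and "mono_on {1..p} \<beta>"
    and "\<And>k. k \<in> {1..p} \<Longrightarrow> (\<Sum>j=1..k. \<alpha> j) \<le> (\<Sum>j=1..k. \<beta> j)"
    and "\<And>i. i \<in> {1..p} \<Longrightarrow> A i = 1 / \<alpha> i"
    and "\<And>i. i \<in> {1..p} \<Longrightarrow> B i = 1 / \<beta> i"
    and "Y > X" and "X > 0"
    and "\<And>a. F a = (\<Prod>i=1..p. (Gamma (A i * X + a) * Gamma (B i * Y + a)) /
                               (Gamma (A i * Y + a) * Gamma (B i * X + a)))"
  shows "antimono_on {1..} F"
proof (rule monotone_onI)
  have pos: "\<alpha> i > 0" "\<beta> i > 0" if "i \<in> {1..p}" for i
    using mono_onD[OF assms(3), of 1 i] mono_onD[OF assms(5), of 1 i] assms(2,4) that by auto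
  define L where "L a = (\<Sum>i=1..p. ln_Gamma (X / \<alpha> i + a) + ln_Gamma (Y / \<beta> i + a)
                          - (ln_Gamma (Y / \<alpha> i + a) + ln_Gamma (X / \<beta> i + a)))" for a
  have gt0: "X / \<alpha> i + a > 0" "Y / \<alpha> i + a > 0" "X / \<beta> i + a > 0" "Y / \<beta> i + a > 0"
    if "i \<in> {1..p}" "a \<ge> 1" for i a
    using pos[OF that(1)] that(2) \<open>X > 0\<close> \<open>Y > X\<close> by (auto intro!: add_pos_pos)
  have F: "F a = exp (L a)" if "a \<ge> 1" for a
    unfolding assms(11) L_def exp_sum[OF finite_atLeastAtMost]
  proof (rule prod.cong[OF refl])
    fix i assume i: "i \<in> {1..p}"
    show "(Gamma (A i * X + a) * Gamma (B i * Y + a)) / (Gamma (A i * Y + a) * Gamma (B i * X + a))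
      = exp (ln_Gamma (X / \<alpha> i + a) + ln_Gamma (Y / \<beta> i + a)
               - (ln_Gamma (Y / \<alpha> i + a) + ln_Gamma (X / \<beta> i + a)))"
      using gt0[OF i that] by (simp add: assms(7,8)[OF i] exp_diff exp_add Gamma_real_pos_exp)
  qed
  fix x y :: real assume xy: "x \<in> {1..}" "y \<in> {1..}" "x \<le> y"
  have "L y \<le> L x"
  proof (rule DERIV_nonpos_imp_nonincreasing[OF xy(3)])
    fix a assume "x \<le> a" "a \<le> y"
    with xy have a: "a \<ge> 1" by simp
    have "(L has_real_derivative
        (\<Sum>i=1..p. Digamma (X / \<alpha> i + a) + Digamma (Y / \<beta> i + a)
                   - (Digamma (Y / \<alpha> i + a) + Digamma (X / \<beta> i + a)))) (at a)"
      unfolding L_def[abs_def]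
      by (rule DERIV_sum) (use gt0[OF _ a] in \<open>auto intro!: derivative_eq_intros\<close>)
    moreover have "(\<Sum>i=1..p. Digamma (X / \<alpha> i + a) + Digamma (Y / \<beta> i + a)
                   - (Digamma (Y / \<alpha> i + a) + Digamma (X / \<beta> i + a))) \<le> 0"
      using sum_Digamma_diff_le[OF a \<open>X > 0\<close> \<open>Y > X\<close> \<open>p \<ge> 1\<close> pos assms(5,6)]
      by (simp add: sum_subtractf sum.distrib)
    ultimately show "\<exists>d. (L has_real_derivative d) (at a) \<and> d \<le> 0" by blast
  qed
  then show "F x \<ge> F y" using xy by (simp add: F)
qed

end
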